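(* Let $d\ge 1$ be an odd integer and let $k\ge 0$ be an integer. Then there exists a function $\psi\in\Psi_d$ which is $2k$ times differentiable at zero but whose derivative of order $2k+[(d-1)/2]+1$ does not exist on $(0,\pi)$, i.e. there is a point of $(0,\pi)$ at which the derivative of $\psi$ of order $2k+[(d-1)/2]+1$ fails to exist.
   Context: For an integer $d\ge 1$, $\mathbb{S}^d=\{x\in\mathbb{R}^{d+1}:\|x\|=1\}$ and $\theta(x,y)=\arccos(\langle x,y\rangle)$ for $x,y\in\mathbb{S}^d$. A function $g:\mathbb{S}^d\times\mathbb{S}^d\to\mathbb{R}$ is positive definite if $\sum_{i=1}^n\sum_{j=1}^n c_ic_j g(x_i,x_j)\ge 0$ for all $n \ge 1$, $x_1,\dots,x_n\in\mathbb{S}^d$ and $c_1,\dots,c_n\in\mathbb{R}$. $\Psi_d$ is the class of continuous functions $\psi:[0,\pi]\to\mathbb{R}$ with $\psi(0)=1$ such that $g(x,y)=\psi(\theta(x,y))$ is positive definite on $\mathbb{S}^d$. Convention: "$\psi$ is $2k$ times differentiable at zero" means that the even continuation $\theta\mapsto\psi(|\theta|)$, $\theta\in[-\pi,\pi]$, has $2k$ (finite) derivatives at $\theta=0$ (no condition if $k=0$). $[x]$ denotes the integer part of $x$. *)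

theory Defs
  imports "HOL-Analysis.Analysis"
begin

definition positive_definite_on :: "'a set \<Rightarrow> ('a \<Rightarrow> 'a \<Rightarrow> real) \<Rightarrow> bool" where
  "positive_definite_on S g \<longleftrightarrow>
     (\<forall>n\<ge>1. \<forall>(x :: nat \<Rightarrow> 'a) (c :: nat \<Rightarrow> real). (\<forall>i\<in>{1..n}. x i \<in> S) \<longrightarrow>
        (\<Sum>i=1..n. \<Sum>j=1..n. c i * c j * g (x i) (x j)) \<ge> 0)"

definition sphere_angle :: "real ^ 'n \<Rightarrow> real ^ 'n \<Rightarrow> real" where
  "sphere_angle x y = arccos (x \<bullet> y)"

text \<open>
  The class \<open>\<Psi>\<^sub>d\<close>, where \<open>d + 1 = CARD('n)\<close> is the dimension of the ambient space of the
  unit sphere \<open>S\<^sup>d\<close>. A function on \<open>[0, pi]\<close> is represented by a total function on the reals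
  whose values outside \<open>[0, pi]\<close> play no role.
\<close>
definition Psi_class :: "'n::finite itself \<Rightarrow> (real \<Rightarrow> real) set" where
  "Psi_class _ = {\<psi>. continuous_on {0..pi} \<psi> \<and> \<psi> 0 = 1 \<and>
     positive_definite_on (sphere (0 :: real ^ 'n) 1) (\<lambda>x y. \<psi> (sphere_angle x y))}"

text \<open>
  Existence of the finite derivative of order \<open>m\<close> at the point \<open>x\<close>. For the derivative of order
  \<open>m + 1\<close> at \<open>x\<close> to make sense, the one of order \<open>m\<close> has to exist in a neighbourhood of \<open>x\<close>
  (so that there \<open>(deriv ^^ m) f\<close> is that derivative, and not an arbitrary value).
\<close>
fun times_differentiable_at :: "nat \<Rightarrow> (real \<Rightarrow> real) \<Rightarrow> real \<Rightarrow> bool" where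
  "times_differentiable_at 0 f x \<longleftrightarrow> True"
| "times_differentiable_at (Suc m) f x \<longleftrightarrow>
     (\<forall>\<^sub>F y in nhds x. times_differentiable_at m f y) \<and> ((deriv ^^ m) f) differentiable (at x)"

definition times_differentiable_at_zero :: "nat \<Rightarrow> (real \<Rightarrow> real) \<Rightarrow> bool" where
  "times_differentiable_at_zero m \<psi> \<longleftrightarrow> times_differentiable_at m (\<lambda>\<theta>. \<psi> \<bar>\<theta>\<bar>) 0"

end

(*
  Write d = 2 m + 1 and M = m + k. For the Chebyshev polynomials T n, the m-th derivatives
  T n^(m) are multiples of the Gegenbauer polynomials of S^d, hence positive definite on S^d, and
  on the circle they are nonnegative combinations of cosines with value at most n^(2 m) at 0.
  The function psi is the normalised lacunary sum over the frequencies n = 4^(j + 1) of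
  n^(-2 M - 1) T n^(m) (cos t). Its derivatives of order at most 2 k converge normally.
  Let f i be the sum with T n^(i) in place of T n^(m), so that f i' = - sin * f (i + 1). If psi
  were 2 k + m + 1 times differentiable at pi / 2, then f 0 would be 2 M + 1 times differentiable
  there; but its derivative of order 2 M is, up to sign, the sum of cos (n t) / n, which has a
  cusp at pi / 2.

  Positive definiteness of the Gegenbauer polynomials avoids integration and the addition theorem:
  the kernel <x, y>^n is a finite sum of squares of features, and applying
  (Laplacian - eigenvalue) in both arguments preserves this and removes an eigencomponent, so
  that only the component of degree n survives.
*)

theory Submission imports Defs "HOL-Computational_Algebra.Polynomial" begin

section \<open>Chebyshev polynomials and their derivatives\<close>

fun Tcheb :: "nat \<Rightarrow> real poly" where
  "Tcheb 0 = 1"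
| "Tcheb (Suc 0) = [:0, 1:]"
| "Tcheb (Suc (Suc n)) = [:0, 2:] * Tcheb (Suc n) - Tcheb n"

lemma poly_Tcheb_cos: "poly (Tcheb n) (cos t) = cos (real n * t)"
proof (induction n rule: Tcheb.induct)
  case (3 n)
  have "cos (real (Suc (Suc n)) * t) + cos (real n * t) = 2 * cos t * cos (real (Suc n) * t)"
    using cos_add[of "real (Suc n) * t" t] cos_diff[of "real (Suc n) * t" t]
    by (simp add: algebra_simps)
  then show ?case
    using 3 by simp
qed auto

lemma poly_Tcheb_1 [simp]: "poly (Tcheb n) 1 = 1"
  using poly_Tcheb_cos[of n 0] by simp

text \<open>\<open>cos\<close> maps the open interval from 0 to \<open>pi\<close> onto the infinite
  set between -1 and 1. Leaving out the endpoints lets a later proof divide by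
  \<open>sin t\<close>.\<close>

lemma poly_cos_eqI:
  fixes p q :: "real poly"
  assumes "\<And>t. 0 < t \<Longrightarrow> t < pi \<Longrightarrow> poly p (cos t) = poly q (cos t)"
  shows "p = q"
proof (rule ccontr)
  assume "p \<noteq> q"
  then have "finite {x. poly (p - q) x = 0}"
    by (intro poly_roots_finite) auto
  moreover have "{-1<..<1::real} \<subseteq> {x. poly (p - q) x = 0}"
  proof
    fix u :: real assume "u \<in> {-1<..<1}"
    then have "0 < arccos u" "arccos u < pi" "cos (arccos u) = u"
      using arccos_lt_bounded[of u] by auto
    then show "u \<in> {x. poly (p - q) x = 0}"
      using assms[of "arccos u"] by simp
  qed
  ultimately have "finite {-1<..<1::real}"
    using finite_subset by blast
  then show False
    by (simp add: infinite_Ioo)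
qed

text \<open>Differentiate \<open>poly_Tcheb_cos\<close> in \<open>t\<close>. Keeping the factor
  \<open>sin t\<close> on the left makes the identity valid everywhere, so that it can be
  differentiated once more.\<close>

lemma poly_pderiv_Tcheb_cos:
  "poly (pderiv (Tcheb n)) (cos t) * sin t = real n * sin (real n * t)"
proof -
  have "((\<lambda>t. poly (Tcheb n) (cos t)) has_real_derivative
          poly (pderiv (Tcheb n)) (cos t) * (- sin t)) (at t)"
    by (auto intro!: derivative_eq_intros)
  moreover have "((\<lambda>t. poly (Tcheb n) (cos t)) has_real_derivative - real n * sin (real n * t)) (at t)"
    unfolding poly_Tcheb_cos by (auto intro!: derivative_eq_intros)
  ultimately show ?thesis
    using DERIV_unique by fastforce
qed

section \<open>The Gegenbauer differential equation\<close>

text \<open>With \<open>d = 2 * m + 1\<close> this is \<open>(1 - x^2) p'' - d x p'\<close>, the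
  Laplace-Beltrami operator of the \<open>d\<close>-dimensional sphere on functions of
  \<open>x = <u, v>\<close> with \<open>v\<close> fixed; \<open>m = 0\<close> is the Chebyshev
  operator.\<close>

definition gegenbauer_op :: "nat \<Rightarrow> real poly \<Rightarrow> real poly" where
  "gegenbauer_op m p =
     [:1, 0, -1:] * pderiv (pderiv p) - smult (2 * real m + 1) ([:0, 1:] * pderiv p)"

text \<open>Differentiating \<open>poly_pderiv_Tcheb_cos\<close> and writing
  \<open>sin t ^ 2\<close> as \<open>1 - cos t ^ 2\<close> gives the Chebyshev equation.\<close>

lemma gegenbauer_op_Tcheb: "gegenbauer_op 0 (Tcheb n) = smult (- (real n)\<^sup>2) (Tcheb n)"
proof (rule poly_cos_eqI)
  fix t :: real
  let ?p = "pderiv (Tcheb n)"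
  have "((\<lambda>t. poly ?p (cos t) * sin t) has_real_derivative
          poly (pderiv ?p) (cos t) * (- sin t) * sin t + cos t * poly ?p (cos t)) (at t)"
    by (auto intro!: derivative_eq_intros)
  moreover have "((\<lambda>t. poly ?p (cos t) * sin t) has_real_derivative
      real n * (real n * cos (real n * t))) (at t)"
    unfolding poly_pderiv_Tcheb_cos by (auto intro!: derivative_eq_intros)
  ultimately have "poly (pderiv ?p) (cos t) * (- sin t) * sin t + cos t * poly ?p (cos t)
      = real n * (real n * cos (real n * t))"
    by (rule DERIV_unique)
  moreover have "poly (pderiv ?p) (cos t) * (1 - cos t * cos t) = poly (pderiv ?p) (cos t) * (sin t * sin t)"
    using sin_cos_squared_add[of t] by (simp add: power2_eq_square eq_diff_eq[symmetric])
  ultimately show "poly (gegenbauer_op 0 (Tcheb n)) (cos t) = poly (smult (- (real n)\<^sup>2) (Tcheb n)) (cos t)"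
    by (simp add: gegenbauer_op_def poly_Tcheb_cos algebra_simps power2_eq_square)
qed

text \<open>Differentiating the factors \<open>1 - x^2\<close> and \<open>x\<close> turns the
  coefficient \<open>2 m + 1\<close> into the \<open>2 m + 3\<close> of the next operator and leaves
  a multiple of \<open>p'\<close>.\<close>

lemma gegenbauer_op_pderiv:
  "gegenbauer_op (Suc m) (pderiv p) = pderiv (gegenbauer_op m p) + smult (2 * real m + 1) (pderiv p)"
  by (rule poly_ext)
    (simp add: gegenbauer_op_def pderiv_diff pderiv_add pderiv_minus pderiv_mult pderiv_smult pderiv_pCons algebra_simps)

text \<open>Each derivative raises the eigenvalue by \<open>2 m + 1 = (m + 1)^2 - m^2\<close>,
  starting from the Chebyshev equation.\<close>

lemma gegenbauer_op_pderiv_Tcheb: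
  "gegenbauer_op m ((pderiv ^^ m) (Tcheb n))
     = smult ((real m)\<^sup>2 - (real n)\<^sup>2) ((pderiv ^^ m) (Tcheb n))"
proof (induction m)
  case 0
  then show ?case by (simp add: gegenbauer_op_Tcheb)
next
  case (Suc m)
  then show ?case
    by (simp add: gegenbauer_op_pderiv pderiv_smult smult_add_left[symmetric] del: smult_add_left)
      (simp add: algebra_simps power2_eq_square)
qed

lemma gegenbauer_op_add: "gegenbauer_op m (p + q) = gegenbauer_op m p + gegenbauer_op m q"
  and gegenbauer_op_smult: "gegenbauer_op m (smult a p) = smult a (gegenbauer_op m p)"
  by (rule poly_ext; simp add: gegenbauer_op_def pderiv_add pderiv_smult algebra_simps)+

lemma gegenbauer_op_sum:
  "finite I \<Longrightarrow> gegenbauer_op m (\<Sum>i\<in>I. f i) = (\<Sum>i\<in>I. gegenbauer_op m (f i))"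
proof (induction I rule: finite_induct)
  case empty
  then show ?case by (simp add: gegenbauer_op_def)
qed (simp add: gegenbauer_op_add)

section \<open>Nonnegative combinations of Chebyshev polynomials\<close>

text \<open>At \<open>x = cos t\<close> the members are cosine sums of degree at most
  \<open>n\<close> with nonnegative coefficients. Their maximal modulus on [-1, 1] is the value at
  1, so estimates reduce to that point.\<close>

definition Tcone :: "nat \<Rightarrow> real poly set" where
  "Tcone n = {p. \<exists>c. (\<forall>l. 0 \<le> c l) \<and> p = (\<Sum>l\<le>n. smult (c l) (Tcheb l))}"

lemma Tcone_zero: "0 \<in> Tcone n"
  unfolding Tcone_def by (auto intro!: exI[of _ "\<lambda>_. 0"])

lemma Tcone_add: "p \<in> Tcone n \<Longrightarrow> q \<in> Tcone n \<Longrightarrow> p + q \<in> Tcone n"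
  unfolding Tcone_def mem_Collect_eq
proof (elim exE conjE)
  fix c d :: "nat \<Rightarrow> real"
  assume "\<forall>l. 0 \<le> c l" "p = (\<Sum>l\<le>n. smult (c l) (Tcheb l))"
    and "\<forall>l. 0 \<le> d l" "q = (\<Sum>l\<le>n. smult (d l) (Tcheb l))"
  then show "\<exists>c. (\<forall>l. 0 \<le> c l) \<and> p + q = (\<Sum>l\<le>n. smult (c l) (Tcheb l))"
    by (intro exI[of _ "\<lambda>l. c l + d l"]) (simp add: smult_add_left sum.distrib)
qed

lemma Tcone_smult: "p \<in> Tcone n \<Longrightarrow> 0 \<le> a \<Longrightarrow> smult a p \<in> Tcone n"
  unfolding Tcone_def mem_Collect_eq
proof (elim exE conjE)
  fix c :: "nat \<Rightarrow> real"
  assume "\<forall>l. 0 \<le> c l" "p = (\<Sum>l\<le>n. smult (c l) (Tcheb l))" "0 \<le> a"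
  then show "\<exists>c. (\<forall>l. 0 \<le> c l) \<and> smult a p = (\<Sum>l\<le>n. smult (c l) (Tcheb l))"
    by (intro exI[of _ "\<lambda>l. a * c l"]) (auto intro!: poly_ext simp: poly_sum sum_distrib_left mult.assoc)
qed

lemma Tcone_sum: "finite I \<Longrightarrow> (\<And>i. i \<in> I \<Longrightarrow> f i \<in> Tcone n) \<Longrightarrow> (\<Sum>i\<in>I. f i) \<in> Tcone n"
  by (induction I rule: finite_induct) (auto intro: Tcone_zero Tcone_add)

lemma Tcheb_in_Tcone: "l \<le> n \<Longrightarrow> Tcheb l \<in> Tcone n"
  unfolding Tcone_def
  by (auto intro!: exI[of _ "\<lambda>i. if i = l then 1 else 0"] simp: if_distrib[of "\<lambda>c. smult c _"] cong: if_cong)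

text \<open>This is \<open>sin ((n + 2) t) - sin (n t) = 2 cos ((n + 1) t) sin t\<close>, rewritten
  by \<open>poly_pderiv_Tcheb_cos\<close> and divided by \<open>sin t\<close>. The factor
  \<open>n (n + 2)\<close> avoids fractions; for \<open>n = 0\<close> both sides vanish.\<close>

lemma pderiv_Tcheb_rec:
  "smult (real n) (pderiv (Tcheb (n + 2)))
     = smult (real n + 2) (pderiv (Tcheb n)) + smult (2 * real n * (real n + 2)) (Tcheb (n + 1))"
proof (rule poly_cos_eqI)
  fix t :: real
  assume "0 < t" "t < pi"
  then have s: "sin t \<noteq> 0"
    using sin_gt_zero by force
  have "sin ((real n + 2) * t) - sin (real n * t) = 2 * cos ((real n + 1) * t) * sin t"
    using sin_add[of "(real n + 1) * t" t] sin_diff[of "(real n + 1) * t" t]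
    by (simp add: algebra_simps)
  then have "real n * (poly (pderiv (Tcheb (n + 2))) (cos t) * sin t)
      = (real n + 2) * (poly (pderiv (Tcheb n)) (cos t) * sin t)
        + 2 * real n * (real n + 2) * cos ((real n + 1) * t) * sin t"
    unfolding poly_pderiv_Tcheb_cos by (simp add: algebra_simps)
  then have "(real n * poly (pderiv (Tcheb (n + 2))) (cos t)) * sin t
      = ((real n + 2) * poly (pderiv (Tcheb n)) (cos t)
        + 2 * real n * (real n + 2) * cos ((real n + 1) * t)) * sin t"
    by (simp add: algebra_simps)
  then have "real n * poly (pderiv (Tcheb (n + 2))) (cos t)
      = (real n + 2) * poly (pderiv (Tcheb n)) (cos t)
        + 2 * real n * (real n + 2) * cos ((real n + 1) * t)"
    using s by (simp only: mult_cancel_right) simp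
  then show "poly (smult (real n) (pderiv (Tcheb (n + 2)))) (cos t)
     = poly (smult (real n + 2) (pderiv (Tcheb n))
        + smult (2 * real n * (real n + 2)) (Tcheb (n + 1))) (cos t)"
    using poly_Tcheb_cos[of "n + 1" t] by (simp add: add.commute)
qed

text \<open>The coefficients in \<open>pderiv_Tcheb_rec\<close> are nonnegative, so membership
  propagates in steps of two.\<close>

lemma pderiv_Tcheb_in_Tcone: "l \<le> n \<Longrightarrow> pderiv (Tcheb l) \<in> Tcone n"
proof (induction l rule: less_induct)
  case (less l)
  \<comment> \<open>The value 2 needs its own case: the recurrence that would reach it has the
    factor 0 on its left side.\<close>
  consider "l = 0" | "l = 1" | "l = 2" | k where "l = k + 2" "k > 0"
    by (metis One_nat_def Suc_1 add_2_eq_Suc' gr0I less_2_cases not_less_eq old.nat.exhaust)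
  then show ?case
  proof cases
    case 1
    then show ?thesis by (simp add: Tcone_zero)
  next
    case 2
    then have "pderiv (Tcheb l) = Tcheb 0"
      by (simp add: pderiv_pCons)
    then show ?thesis by (metis Tcheb_in_Tcone le0)
  next
    case 3
    then have "pderiv (Tcheb l) = smult 4 (Tcheb 1)"
      by (simp add: numeral_2_eq_2 pderiv_diff pderiv_mult pderiv_pCons)
    moreover have "Tcheb 1 \<in> Tcone n"
      using 3 less.prems by (intro Tcheb_in_Tcone) auto
    ultimately show ?thesis
      by (simp add: Tcone_smult del: Tcheb.simps)
  next
    case 4
    have "pderiv (Tcheb l) = smult (1 / real k) (smult (real k) (pderiv (Tcheb (k + 2))))"
      using 4 by (simp del: Tcheb.simps)
    also have "\<dots> \<in> Tcone n"
      unfolding pderiv_Tcheb_rec using 4 less.prems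
      by (intro Tcone_smult Tcone_add less.IH Tcheb_in_Tcone) auto
    finally show ?thesis .
  qed
qed

lemma pderiv_sum: "finite I \<Longrightarrow> pderiv (\<Sum>i\<in>I. f i) = (\<Sum>i\<in>I. pderiv (f i))"
  for f :: "'b \<Rightarrow> real poly"
  by (induction I rule: finite_induct) (auto simp: pderiv_add)

lemma pderiv_in_Tcone:
  assumes "p \<in> Tcone n" shows "pderiv p \<in> Tcone n"
proof -
  obtain c where c: "\<forall>l. 0 \<le> c l" and p: "p = (\<Sum>l\<le>n. smult (c l) (Tcheb l))"
    using assms unfolding Tcone_def by blast
  show ?thesis
    unfolding p using c
    by (auto simp: pderiv_sum pderiv_smult intro!: Tcone_sum Tcone_smult pderiv_Tcheb_in_Tcone)
qed

text \<open>At 1 the second-order term of the Chebyshev equation vanishes.\<close>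

lemma poly_pderiv_Tcheb_1: "poly (pderiv (Tcheb n)) 1 = (real n)\<^sup>2"
  using arg_cong[OF gegenbauer_op_Tcheb[of n], of "\<lambda>p. poly p 1"] by (simp add: gegenbauer_op_def)

text \<open>A Markov inequality at the endpoint: each \<open>T l\<close> contributes
  \<open>l^2\<close>, which is at most \<open>n^2\<close>, with a nonnegative weight.\<close>

lemma poly_pderiv_1_le:
  assumes "p \<in> Tcone n" shows "poly (pderiv p) 1 \<le> (real n)\<^sup>2 * poly p 1"
proof -
  obtain c where c: "\<forall>l. 0 \<le> c l" and p: "p = (\<Sum>l\<le>n. smult (c l) (Tcheb l))"
    using assms unfolding Tcone_def by blast
  have "poly (pderiv p) 1 = (\<Sum>l\<le>n. c l * (real l)\<^sup>2)"
    unfolding p by (simp add: pderiv_sum pderiv_smult poly_sum poly_pderiv_Tcheb_1)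
  also have "\<dots> \<le> (\<Sum>l\<le>n. c l * (real n)\<^sup>2)"
    using c by (intro sum_mono mult_left_mono power_mono) auto
  also have "\<dots> = (real n)\<^sup>2 * poly p 1"
    unfolding p by (simp add: poly_sum sum_distrib_right mult.commute)
  finally show ?thesis .
qed

abbreviation gegen :: "nat \<Rightarrow> nat \<Rightarrow> real poly" where
  "gegen m n \<equiv> (pderiv ^^ m) (Tcheb n)"

lemma gegen_in_Tcone: "gegen m n \<in> Tcone n"
  by (induction m) (auto intro: pderiv_in_Tcone Tcheb_in_Tcone)

lemma poly_gegen_1_le: "poly (gegen m n) 1 \<le> real n ^ (2 * m)"
proof (induction m)
  case (Suc m)
  have "poly (gegen (Suc m) n) 1 \<le> (real n)\<^sup>2 * poly (gegen m n) 1"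
    using poly_pderiv_1_le[OF gegen_in_Tcone] by simp
  also have "\<dots> \<le> (real n)\<^sup>2 * real n ^ (2 * m)"
    using Suc by (intro mult_left_mono) auto
  finally show ?case
    by (simp add: power_add[symmetric])
qed simp

text \<open>At 1 the Gegenbauer equation reduces to a first-order relation that carries positivity
  to the next derivative as long as \<open>m < n\<close>.\<close>

lemma poly_gegen_1_pos: "m \<le> n \<Longrightarrow> 0 < poly (gegen m n) 1"
proof (induction m)
  case (Suc m)
  have "(2 * real m + 1) * poly (gegen (Suc m) n) 1 = ((real n)\<^sup>2 - (real m)\<^sup>2) * poly (gegen m n) 1"
    using arg_cong[OF gegenbauer_op_pderiv_Tcheb[of m n], of "\<lambda>p. poly p 1"]
    by (simp add: gegenbauer_op_def algebra_simps)
  moreover have "(real m)\<^sup>2 < (real n)\<^sup>2"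
    using Suc.prems by (intro power_strict_mono) auto
  ultimately have "0 < (2 * real m + 1) * poly (gegen (Suc m) n) 1"
    using Suc by simp
  then show ?case
    by (simp add: zero_less_mult_iff)
qed simp

section \<open>Leading coefficients and expansion in Gegenbauer polynomials\<close>

lemma coeff_Tcheb: "n < i \<Longrightarrow> coeff (Tcheb n) i = 0" "0 < coeff (Tcheb n) n"
proof -
  have "(\<forall>i>n. coeff (Tcheb n) i = 0) \<and> 0 < coeff (Tcheb n) n" for n
  proof (induction n rule: Tcheb.induct)
    case (3 n)
    then show ?case
      by (auto simp: coeff_pCons split: nat.splits)
  qed (auto simp: coeff_pCons split: nat.splits)
  then show "n < i \<Longrightarrow> coeff (Tcheb n) i = 0" "0 < coeff (Tcheb n) n"
    by auto
qed

lemma coeff_gegen: "n < i \<Longrightarrow> coeff (gegen m (n + m)) i = 0" "0 < coeff (gegen m (n + m)) n"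
proof -
  have "(\<forall>i>n. coeff (gegen m (n + m)) i = 0) \<and> 0 < coeff (gegen m (n + m)) n" for n m
  proof (induction m arbitrary: n)
    case 0
    then show ?case using coeff_Tcheb by simp
  next
    case (Suc m)
    from Suc[of "Suc n"] show ?case
      by (simp add: coeff_pderiv)
  qed
  then show "n < i \<Longrightarrow> coeff (gegen m (n + m)) i = 0" "0 < coeff (gegen m (n + m)) n"
    by auto
qed

text \<open>\<open>gegen m (i + m)\<close> has exact degree \<open>i\<close>, so leading terms can
  be removed one after the other. The second conjunct later gives the sign of the top
  coefficient.\<close>

lemma gegen_expansion:
  assumes "degree p \<le> n"
  shows "\<exists>\<beta>. p = (\<Sum>i\<le>n. smult (\<beta> i) (gegen m (i + m))) \<and>
    \<beta> n * coeff (gegen m (n + m)) n = coeff p n"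
  using assms
proof (induction n arbitrary: p)
  case 0
  let ?b = "coeff p 0 / coeff (gegen m (0 + m)) 0"
  have pos: "0 < coeff (gegen m (0 + m)) 0"
    by (rule coeff_gegen)
  have "coeff p i = coeff (smult ?b (gegen m (0 + m))) i" for i
  proof (cases "i = 0")
    case True
    then show ?thesis using pos by simp
  next
    case False
    then show ?thesis
      using 0 coeff_eq_0[of p i] coeff_gegen(1)[of 0 i m] by simp
  qed
  then have "p = smult ?b (gegen m (0 + m))"
    by (rule poly_eqI)
  then show ?case
    using pos by (intro exI[of _ "\<lambda>_. ?b"]) simp
next
  case (Suc n)
  let ?q = "gegen m (Suc n + m)"
  let ?b = "coeff p (Suc n) / coeff ?q (Suc n)"
  have pos: "0 < coeff ?q (Suc n)"
    by (rule coeff_gegen)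
  have "coeff (p - smult ?b ?q) i = 0" if "i > n" for i
  proof (cases "i = Suc n")
    case True
    then show ?thesis using pos by (simp del: funpow.simps)
  next
    case False
    then have "i > Suc n" using that by simp
    then show ?thesis
      using Suc.prems coeff_eq_0[of p i] coeff_gegen(1)[of "Suc n" i m] by (simp del: funpow.simps)
  qed
  then have "degree (p - smult ?b ?q) \<le> n"
    by (intro degree_le) blast
  from Suc.IH[OF this] obtain \<beta> where \<beta>: "p - smult ?b ?q = (\<Sum>i\<le>n. smult (\<beta> i) (gegen m (i + m)))"
    by blast
  have "p = (\<Sum>i\<le>n. smult (\<beta> i) (gegen m (i + m))) + smult ?b ?q"
    unfolding \<beta>[symmetric] by simp
  then show ?case
    using pos by (intro exI[of _ "\<beta>(Suc n := ?b)"]) (simp del: funpow.simps Tcheb.simps)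
qed

section \<open>Positive definiteness on the sphere\<close>

text \<open>The generator of the rotations that turn axis \<open>a\<close> towards axis
  \<open>b\<close>; it is zero for \<open>a = b\<close>.\<close>

definition skew :: "'n \<Rightarrow> 'n \<Rightarrow> real ^ 'n \<Rightarrow> real ^ 'n" where
  "skew a b x = (x $ a) *\<^sub>R axis b 1 - (x $ b) *\<^sub>R axis a 1"

lemma linear_skew: "linear (skew a b :: real ^ 'n::finite \<Rightarrow> _)"
  by (rule linearI) (simp_all add: skew_def algebra_simps)

lemma inner_skew: "skew a b x \<bullet> y = x $ a * y $ b - x $ b * y $ a" for x y :: "real ^ 'n::finite"
  by (simp add: skew_def inner_diff_left inner_axis')

lemma skew_adjoint: "skew a b x \<bullet> y = - (x \<bullet> skew a b y)" for x y :: "real ^ 'n::finite"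
  by (simp add: inner_skew inner_commute[of x])

lemma skew_cubed: "skew a b (skew a b (skew a b x)) = - skew a b x" for x :: "real ^ 'n::finite"
  by (cases "a = b") (simp_all add: skew_def axis_def vec_eq_iff)

text \<open>With \<open>J = skew a b\<close> this is the exponential of \<open>t J\<close>, in the
  closed form that \<open>J^3 = - J\<close> allows.\<close>

definition rotation :: "'n \<Rightarrow> 'n \<Rightarrow> real \<Rightarrow> real ^ 'n \<Rightarrow> real ^ 'n" where
  "rotation a b t x = x + (1 - cos t) *\<^sub>R skew a b (skew a b x) + sin t *\<^sub>R skew a b x"

lemma rotation_0 [simp]: "rotation a b 0 x = x"
  by (simp add: rotation_def)

text \<open>With \<open>J = skew a b\<close>, the products of \<open>J x\<close> with
  \<open>x\<close> and with \<open>J (J x)\<close> vanish; beyond \<open>x \<bullet> x\<close> only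
  multiples of \<open>J x \<bullet> J x\<close> remain, and their coefficients cancel by
  \<open>sin^2 + cos^2 = 1\<close>.\<close>

lemma norm_rotation: "norm (rotation a b t x) = norm x" for x :: "real ^ 'n::finite"
proof -
  let ?J = "skew a b"
  have 1: "x \<bullet> ?J x = 0" "?J x \<bullet> x = 0"
    using inner_skew[of a b x x] by (simp_all add: inner_commute)
  have 2: "?J (?J x) \<bullet> ?J x = 0" "?J x \<bullet> ?J (?J x) = 0"
    using inner_skew[of a b "?J x" "?J x"] by (simp_all add: inner_commute)
  have 3: "?J (?J x) \<bullet> x = - (?J x \<bullet> ?J x)" "x \<bullet> ?J (?J x) = - (?J x \<bullet> ?J x)"
    using skew_adjoint[of a b "?J x" x] by (simp_all add: inner_commute)
  have 4: "?J (?J x) \<bullet> ?J (?J x) = ?J x \<bullet> ?J x"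
    by (simp add: skew_adjoint[of a b "?J x"] skew_cubed)
  let ?w = "?J x \<bullet> ?J x"
  have "rotation a b t x \<bullet> rotation a b t x
      = x \<bullet> x + ((1 - cos t) * (1 - cos t) + sin t * sin t - 2 * (1 - cos t)) * ?w"
    unfolding rotation_def
    by (simp add: inner_add_left inner_add_right 1 2 3 4) (simp only: algebra_simps)
  also have "(1 - cos t) * (1 - cos t) + sin t * sin t - 2 * (1 - cos t) = 0"
    using sin_cos_squared_add[of t] by (simp add: algebra_simps power2_eq_square)
  finally show ?thesis
    by (simp add: norm_eq_sqrt_inner)
qed

text \<open>The angular derivative \<open>x_a d_b - x_b d_a\<close>. It is tangential to the
  sphere.\<close>

definition rotation_deriv :: "'n \<Rightarrow> 'n \<Rightarrow> (real ^ 'n \<Rightarrow> real) \<Rightarrow> real ^ 'n \<Rightarrow> real" where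
  "rotation_deriv a b \<phi> x = deriv (\<lambda>t. \<phi> (rotation a b t x)) 0"

lemma rotation_deriv_polynomial:
  fixes \<phi> :: "real ^ 'n::finite \<Rightarrow> real"
  assumes "real_polynomial_function \<phi>"
  shows "real_polynomial_function (rotation_deriv a b \<phi>)"
    and "((\<lambda>t. \<phi> (rotation a b t x)) has_real_derivative rotation_deriv a b \<phi> x) (at 0)"
proof -
  have "\<exists>\<phi>'. real_polynomial_function \<phi>' \<and>
      (\<forall>x. ((\<lambda>t. \<phi> (rotation a b t x)) has_real_derivative \<phi>' x) (at 0))"
    using assms
  proof (induction rule: real_polynomial_function.induct)
    case (linear f)
    then have lin: "linear f"
      by (simp add: bounded_linear.linear)
    have eq: "f (rotation a b t x)
        = f x + (1 - cos t) * f (skew a b (skew a b x)) + sin t * f (skew a b x)" for t x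
      by (simp add: rotation_def linear_add[OF lin] linear_cmul[OF lin])
    have "bounded_linear (\<lambda>x. f (skew a b x))"
      using linear_compose[OF linear_skew lin] by (simp add: linear_conv_bounded_linear o_def)
    moreover have "((\<lambda>t. f (rotation a b t x)) has_real_derivative f (skew a b x)) (at 0)" for x
      unfolding eq by (auto intro!: derivative_eq_intros)
    ultimately show ?case
      by blast
  next
    case (const c)
    show ?case
      by (rule exI[of _ "\<lambda>_. 0"]) auto
  next
    case (add f g)
    then obtain f' g' where "real_polynomial_function f'" "real_polynomial_function g'"
      and d: "\<And>x. ((\<lambda>t. f (rotation a b t x)) has_real_derivative f' x) (at 0)"
        "\<And>x. ((\<lambda>t. g (rotation a b t x)) has_real_derivative g' x) (at 0)"
      by blast
    then show ?case
      by (intro exI[of _ "\<lambda>x. f' x + g' x"]) (auto intro!: DERIV_add)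
  next
    case (mult f g)
    then obtain f' g' where p: "real_polynomial_function f'" "real_polynomial_function g'"
      and d: "\<And>x. ((\<lambda>t. f (rotation a b t x)) has_real_derivative f' x) (at 0)"
        "\<And>x. ((\<lambda>t. g (rotation a b t x)) has_real_derivative g' x) (at 0)"
      by blast
    have "((\<lambda>t. f (rotation a b t x) * g (rotation a b t x))
        has_real_derivative f' x * g x + g' x * f x) (at 0)" for x
      using DERIV_mult[OF d(1)[of x] d(2)[of x]] by simp
    with p mult.hyps show ?case
      by (intro exI[of _ "\<lambda>x. f' x * g x + g' x * f x"]) auto
  qed
  then obtain \<phi>' where p: "real_polynomial_function \<phi>'"
    and d: "\<And>x. ((\<lambda>t. \<phi> (rotation a b t x)) has_real_derivative \<phi>' x) (at 0)"
    by blast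
  have "rotation_deriv a b \<phi> = \<phi>'"
    unfolding rotation_deriv_def using DERIV_imp_deriv[OF d] by auto
  with p d show "real_polynomial_function (rotation_deriv a b \<phi>)"
    and "((\<lambda>t. \<phi> (rotation a b t x)) has_real_derivative rotation_deriv a b \<phi> x) (at 0)"
    by auto
qed

text \<open>Rotations preserve the sphere, so an identity known only on the sphere may be
  differentiated along them.\<close>

lemma rotation_deriv_unique:
  fixes \<phi> :: "'i \<Rightarrow> real ^ 'n::finite \<Rightarrow> real"
  assumes "\<And>i. i \<in> I \<Longrightarrow> real_polynomial_function (\<phi> i)"
    and eq: "\<And>x. x \<in> sphere 0 1 \<Longrightarrow> g x = (\<Sum>i\<in>I. \<alpha> i * \<phi> i x)"
    and d: "((\<lambda>t. g (rotation a b t x)) has_real_derivative g') (at 0)"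
    and x: "x \<in> sphere 0 1"
  shows "g' = (\<Sum>i\<in>I. \<alpha> i * rotation_deriv a b (\<phi> i) x)"
proof -
  have "((\<lambda>t. \<Sum>i\<in>I. \<alpha> i * \<phi> i (rotation a b t x)) has_real_derivative
      (\<Sum>i\<in>I. \<alpha> i * rotation_deriv a b (\<phi> i) x)) (at 0)"
    by (intro DERIV_sum DERIV_cmult rotation_deriv_polynomial assms(1))
  moreover have "(\<lambda>t. g (rotation a b t x)) = (\<lambda>t. \<Sum>i\<in>I. \<alpha> i * \<phi> i (rotation a b t x))"
    using x by (intro ext eq) (simp add: norm_rotation)
  ultimately show ?thesis
    using d DERIV_unique by simp
qed

section \<open>The spherical Laplacian on zonal functions\<close>

text \<open>On the sphere this is the Laplace-Beltrami operator, the sum of squared angular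
  derivatives over all coordinate planes. Ordered pairs count each plane twice, hence the division
  by 2.\<close>

definition rotation_laplacian :: "(real ^ 'n \<Rightarrow> real) \<Rightarrow> real ^ 'n \<Rightarrow> real" where
  "rotation_laplacian \<phi> x = (\<Sum>a\<in>UNIV. \<Sum>b\<in>UNIV. rotation_deriv a b (rotation_deriv a b \<phi>) x) / 2"

lemma real_polynomial_function_rotation_laplacian:
  fixes \<phi> :: "real ^ 'n::finite \<Rightarrow> real"
  assumes "real_polynomial_function \<phi>"
  shows "real_polynomial_function (rotation_laplacian \<phi>)"
  unfolding rotation_laplacian_def
  by (intro real_polynomial_function_divide real_polynomial_function_sum
      rotation_deriv_polynomial assms) auto

text \<open>Lagrange's identity for two unit vectors.\<close>

lemma sum_skew_squared:
  fixes x y :: "real ^ 'n::finite"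
  assumes "x \<in> sphere 0 1" "y \<in> sphere 0 1"
  shows "(\<Sum>a\<in>UNIV. \<Sum>b\<in>UNIV. (skew a b x \<bullet> y)\<^sup>2) = 2 * (1 - (x \<bullet> y)\<^sup>2)"
proof -
  have n: "(\<Sum>a\<in>UNIV. (x $ a)\<^sup>2) = 1" "(\<Sum>a\<in>UNIV. (y $ a)\<^sup>2) = 1"
    using assms by (simp_all add: norm_eq_1 inner_vec_def power2_eq_square)
  have "(\<Sum>a\<in>UNIV. \<Sum>b\<in>UNIV. (skew a b x \<bullet> y)\<^sup>2)
      = (\<Sum>a\<in>UNIV. \<Sum>b\<in>UNIV. (x $ a)\<^sup>2 * (y $ b)\<^sup>2) + (\<Sum>a\<in>UNIV. \<Sum>b\<in>UNIV. (y $ a)\<^sup>2 * (x $ b)\<^sup>2)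
        - 2 * (\<Sum>a\<in>UNIV. \<Sum>b\<in>UNIV. (x $ a * y $ a) * (x $ b * y $ b))"
    unfolding inner_skew sum_distrib_left sum.distrib[symmetric] sum_subtractf[symmetric]
    by (intro sum.cong refl) (simp add: power2_eq_square algebra_simps)
  also have "\<dots> = 2 * (1 - (x \<bullet> y)\<^sup>2)"
    unfolding sum_product[symmetric] n by (simp add: inner_vec_def power2_eq_square)
  finally show ?thesis .
qed

text \<open>For distinct \<open>a\<close> and \<open>b\<close> the squared generator is minus the
  projection to their plane; the \<open>if\<close> in the proof corrects the diagonal, where it is
  zero.\<close>

lemma sum_skew_skew:
  fixes x y :: "real ^ 'n::finite"
  shows "(\<Sum>a\<in>UNIV. \<Sum>b\<in>UNIV. skew a b (skew a b x) \<bullet> y) = - 2 * (real CARD('n) - 1) * (x \<bullet> y)"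
proof -
  have "skew a b (skew a b x) \<bullet> y
      = (if a = b then 2 * (x $ a * y $ a) else 0) - x $ a * y $ a - x $ b * y $ b" for a b
    by (simp add: inner_skew) (simp add: skew_def axis_def)
  then show ?thesis
    by (simp add: sum_subtractf sum_distrib_left[symmetric])
      (simp add: inner_vec_def algebra_simps)
qed

text \<open>With \<open>J = skew a b\<close>, the chain rule gives
  \<open>f'' <J x, y>^2 + f' <J J x, y>\<close> in each plane; the two preceding sums turn the total
  into \<open>gegenbauer_op m\<close>, as \<open>CARD('n) - 1 = 2 m + 1\<close>. The
  \<open>\<alpha> i\<close> will hold features evaluated at the fixed point
  \<open>y\<close>.\<close>

lemma rotation_laplacian_zonal:
  fixes \<phi> :: "'i \<Rightarrow> real ^ 'n::finite \<Rightarrow> real" and y :: "real ^ 'n"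
  assumes card: "CARD('n) = 2 * m + 2"
    and poly: "\<And>i. i \<in> I \<Longrightarrow> real_polynomial_function (\<phi> i)"
    and y: "y \<in> sphere 0 1"
    and eq: "\<And>x. x \<in> sphere 0 1 \<Longrightarrow> poly f (x \<bullet> y) = (\<Sum>i\<in>I. \<alpha> i * \<phi> i x)"
    and x: "x \<in> sphere 0 1"
  shows "poly (gegenbauer_op m f) (x \<bullet> y) = (\<Sum>i\<in>I. \<alpha> i * rotation_laplacian (\<phi> i) x)"
proof -
  have d0: "((\<lambda>t. rotation a b t x \<bullet> z) has_real_derivative skew a b x \<bullet> z) (at 0)" for a b x and z :: "real ^ 'n"
    unfolding rotation_def inner_add_left inner_scaleR_left
    by (auto intro!: derivative_eq_intros)
  have 1: "poly (pderiv f) (x \<bullet> y) * (skew a b x \<bullet> y) = (\<Sum>i\<in>I. \<alpha> i * rotation_deriv a b (\<phi> i) x)"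
    if "x \<in> sphere 0 1" for a b x
    using that DERIV_chain2[OF poly_DERIV d0, of f a b x y]
    by (intro rotation_deriv_unique[where g = "\<lambda>x. poly f (x \<bullet> y)"] poly eq) auto
  have 2: "poly (pderiv (pderiv f)) (x \<bullet> y) * (skew a b x \<bullet> y)\<^sup>2
        + poly (pderiv f) (x \<bullet> y) * (skew a b (skew a b x) \<bullet> y)
      = (\<Sum>i\<in>I. \<alpha> i * rotation_deriv a b (rotation_deriv a b (\<phi> i)) x)" for a b
  proof (rule rotation_deriv_unique[where g = "\<lambda>x. poly (pderiv f) (x \<bullet> y) * (skew a b x \<bullet> y)"])
    have "((\<lambda>t. skew a b (rotation a b t x) \<bullet> y) has_real_derivative skew a b (skew a b x) \<bullet> y) (at 0)"
      unfolding skew_adjoint[of a b _ y] using DERIV_minus[OF d0] by blast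
    from DERIV_mult[OF DERIV_chain2[OF poly_DERIV d0, of "pderiv f" a b x y] this]
    show "((\<lambda>t. poly (pderiv f) (rotation a b t x \<bullet> y) * (skew a b (rotation a b t x) \<bullet> y))
        has_real_derivative poly (pderiv (pderiv f)) (x \<bullet> y) * (skew a b x \<bullet> y)\<^sup>2
          + poly (pderiv f) (x \<bullet> y) * (skew a b (skew a b x) \<bullet> y)) (at 0)"
      by (simp add: power2_eq_square algebra_simps)
  qed (use x 1 in \<open>auto intro: rotation_deriv_polynomial poly\<close>)
  have "(\<Sum>i\<in>I. \<alpha> i * rotation_laplacian (\<phi> i) x)
      = (\<Sum>a\<in>UNIV. \<Sum>b\<in>UNIV. \<Sum>i\<in>I. \<alpha> i * rotation_deriv a b (rotation_deriv a b (\<phi> i)) x) / 2"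
    unfolding rotation_laplacian_def sum_divide_distrib sum_distrib_left
    by (subst sum.swap, intro sum.cong refl, subst sum.swap) simp
  also have "\<dots> = (poly (pderiv (pderiv f)) (x \<bullet> y) * (2 * (1 - (x \<bullet> y)\<^sup>2))
      + poly (pderiv f) (x \<bullet> y) * (- 2 * (real CARD('n) - 1) * (x \<bullet> y))) / 2"
    unfolding 2[symmetric] sum.distrib sum_distrib_left[symmetric] sum_skew_skew sum_skew_squared[OF x y] ..
  also have "\<dots> = poly (gegenbauer_op m f) (x \<bullet> y)"
    unfolding card by (simp add: gegenbauer_op_def power2_eq_square field_simps)
  finally show ?thesis by simp
qed

section \<open>Kernels that are finite sums of squares of polynomial features\<close>

text \<open>The index type is the one needed for the monomials of \<open>(x \<bullet> y) ^ n\<close>.\<close>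

definition polynomial_features :: "'n::finite itself \<Rightarrow> real poly \<Rightarrow> bool" where
  "polynomial_features _ f \<longleftrightarrow> (\<exists>(I :: (nat \<Rightarrow> 'n) set) (\<phi> :: (nat \<Rightarrow> 'n) \<Rightarrow> real ^ 'n \<Rightarrow> real).
     finite I \<and> (\<forall>i\<in>I. real_polynomial_function (\<phi> i)) \<and>
     (\<forall>x\<in>sphere 0 1. \<forall>y\<in>sphere 0 1. poly f (x \<bullet> y) = (\<Sum>i\<in>I. \<phi> i x * \<phi> i y)))"

text \<open>The quadratic form splits into one square per feature.\<close>

lemma polynomial_features_positive:
  assumes "polynomial_features TYPE('n::finite) f"
    and x: "\<And>i. i \<in> J \<Longrightarrow> x i \<in> sphere (0 :: real ^ 'n) 1"
  shows "0 \<le> (\<Sum>i\<in>J. \<Sum>j\<in>J. c i * c j * poly f (x i \<bullet> x j))"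
proof -
  obtain I and \<phi> :: "(nat \<Rightarrow> 'n) \<Rightarrow> real ^ 'n \<Rightarrow> real" where
    eq: "\<forall>x\<in>sphere 0 1. \<forall>y\<in>sphere 0 1. poly f (x \<bullet> y) = (\<Sum>i\<in>I. \<phi> i x * \<phi> i y)"
    using assms(1) unfolding polynomial_features_def by blast
  have "(\<Sum>i\<in>J. \<Sum>j\<in>J. c i * c j * poly f (x i \<bullet> x j))
      = (\<Sum>i\<in>J. \<Sum>j\<in>J. \<Sum>l\<in>I. (c i * \<phi> l (x i)) * (c j * \<phi> l (x j)))"
    using eq x by (intro sum.cong refl) (simp add: sum_distrib_left mult_ac)
  also have "\<dots> = (\<Sum>i\<in>J. \<Sum>l\<in>I. \<Sum>j\<in>J. (c i * \<phi> l (x i)) * (c j * \<phi> l (x j)))"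
    by (intro sum.cong refl sum.swap)
  also have "\<dots> = (\<Sum>l\<in>I. (\<Sum>i\<in>J. c i * \<phi> l (x i)) * (\<Sum>j\<in>J. c j * \<phi> l (x j)))"
    unfolding sum_product by (rule sum.swap)
  also have "\<dots> \<ge> 0"
    by (intro sum_nonneg) auto
  finally show ?thesis .
qed

text \<open>Expanding the \<open>n\<close>-th power of the inner product gives one feature for each
  word of \<open>n\<close> coordinates.\<close>

lemma polynomial_features_monom: "polynomial_features TYPE('n::finite) (monom 1 n)"
proof -
  let ?I = "PiE {..<n} (\<lambda>_. UNIV :: 'n set)"
  let ?\<phi> = "\<lambda>i (x :: real ^ 'n). \<Prod>j<n. x $ i j"
  have "bounded_linear (\<lambda>x :: real ^ 'n. x $ a)" for a
    by (rule bounded_linear_vec_nth)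
  then have "\<forall>i\<in>?I. real_polynomial_function (?\<phi> i)"
    by (intro ballI real_polynomial_function_prod) auto
  moreover have "poly (monom 1 n) (x \<bullet> y) = (\<Sum>i\<in>?I. ?\<phi> i x * ?\<phi> i y)" for x y
    using prod_sum_PiE[of "{..<n}" "\<lambda>_. UNIV" "\<lambda>_ a. x $ a * y $ a"]
    by (simp add: poly_monom inner_vec_def prod.distrib)
  ultimately show ?thesis
    unfolding polynomial_features_def by (intro exI[of _ ?I] exI[of _ ?\<phi>]) (auto intro: finite_PiE)
qed

text \<open>On the sphere \<open>gegenbauer_op m\<close> is the Laplacian in either argument; a real operator
  applied in both arguments keeps a sum of squares of features.\<close>

lemma polynomial_features_gegenbauer:
  fixes r :: real
  assumes card: "CARD('n::finite) = 2 * m + 2" and f: "polynomial_features TYPE('n) f"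
  defines "A \<equiv> \<lambda>p. gegenbauer_op m p + smult r p"
  shows "polynomial_features TYPE('n) (A (A f))"
proof -
  obtain I and \<phi> :: "(nat \<Rightarrow> 'n) \<Rightarrow> real ^ 'n \<Rightarrow> real" where
    fin: "finite I" and pol: "\<And>i. i \<in> I \<Longrightarrow> real_polynomial_function (\<phi> i)" and
    eq: "\<And>x y. x \<in> sphere 0 1 \<Longrightarrow> y \<in> sphere 0 1 \<Longrightarrow> poly f (x \<bullet> y) = (\<Sum>i\<in>I. \<phi> i x * \<phi> i y)"
    using f unfolding polynomial_features_def by blast
  define \<psi> where "\<psi> i x = rotation_laplacian (\<phi> i) x + r * \<phi> i x" for i x
  have step: "poly (A g) (x \<bullet> y) = (\<Sum>i\<in>I. \<alpha> i * \<psi> i x)"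
    if "x \<in> sphere 0 1" "y \<in> sphere 0 1"
      "\<And>x. x \<in> sphere 0 1 \<Longrightarrow> poly g (x \<bullet> y) = (\<Sum>i\<in>I. \<alpha> i * \<phi> i x)" for g x y \<alpha>
  proof -
    have "poly (gegenbauer_op m g) (x \<bullet> y) = (\<Sum>i\<in>I. \<alpha> i * rotation_laplacian (\<phi> i) x)"
      using that by (intro rotation_laplacian_zonal[OF card pol])
    with that show ?thesis
      by (simp add: A_def \<psi>_def sum.distrib sum_distrib_left algebra_simps)
  qed
  have 1: "poly (A f) (x \<bullet> y) = (\<Sum>i\<in>I. \<psi> i x * \<phi> i y)"
    if "x \<in> sphere 0 1" "y \<in> sphere 0 1" for x y
    using step[of x y f "\<lambda>i. \<phi> i y"] that eq by (simp add: mult.commute)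
  \<comment> \<open>The first application acted on \<open>x\<close>; by symmetry of the inner
    product the second can act on \<open>y\<close>.\<close>
  have "poly (A (A f)) (x \<bullet> y) = (\<Sum>i\<in>I. \<psi> i x * \<psi> i y)"
    if "x \<in> sphere 0 1" "y \<in> sphere 0 1" for x y
    unfolding inner_commute[of x y] using that(2,1)
    by (rule step) (metis 1 that(1) inner_commute)
  moreover have "real_polynomial_function (\<psi> i)" if "i \<in> I" for i
    unfolding \<psi>_def using pol[OF that]
    by (intro real_polynomial_function.intros(2-) real_polynomial_function_rotation_laplacian)
  ultimately show ?thesis
    unfolding polynomial_features_def using fin by blast
qed

text \<open>Starting from \<open>monom 1 n\<close>, components are removed from the lowest degree
  upwards. Applying the shifted operator twice multiplies coefficients by squares, so the top one
  stays positive.\<close>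

lemma polynomial_features_gegen:
  assumes card: "CARD('n::finite) = 2 * m + 2"
  obtains c where "0 < c" "polynomial_features TYPE('n) (smult c (gegen m (n + m)))"
proof -
  have "\<exists>\<beta>. 0 < \<beta> n \<and> polynomial_features TYPE('n) (\<Sum>i\<in>{r..n}. smult (\<beta> i) (gegen m (i + m)))"
    if "r \<le> n" for r
    using that
  proof (induction r)
    case 0
    obtain \<beta> where \<beta>: "monom 1 n = (\<Sum>i\<le>n. smult (\<beta> i) (gegen m (i + m)))"
      "\<beta> n * coeff (gegen m (n + m)) n = coeff (monom 1 n) n"
      using gegen_expansion[OF degree_monom_le, of 1 n m] by blast
    have "0 < \<beta> n * coeff (gegen m (n + m)) n"
      unfolding \<beta>(2) by simp
    then have "0 < \<beta> n"
      by (rule zero_less_mult_pos2[OF _ coeff_gegen(2)])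
    then show ?case
      using \<beta>(1) polynomial_features_monom[where 'n = 'n, of n] by (auto simp: atMost_atLeast0)
  next
    case (Suc r)
    then obtain \<beta> where pos: "0 < \<beta> n"
      and ft: "polynomial_features TYPE('n) (\<Sum>i\<in>{r..n}. smult (\<beta> i) (gegen m (i + m)))"
      by auto
    \<comment> \<open>\<open>w i\<close> is the difference of the eigenvalues of the components
      \<open>i\<close> and \<open>r\<close>: zero at \<open>i = r\<close> and nonzero at
      \<open>i = n\<close>.\<close>
    define w where "w i = (real m)\<^sup>2 - (real (i + m))\<^sup>2 - ((real m)\<^sup>2 - (real (r + m))\<^sup>2)" for i
    define A where "A p = gegenbauer_op m p + smult (- ((real m)\<^sup>2 - (real (r + m))\<^sup>2)) p" for p
    have A: "A (\<Sum>i\<in>{r..n}. smult (\<gamma> i) (gegen m (i + m)))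
        = (\<Sum>i\<in>{r..n}. smult (\<gamma> i * w i) (gegen m (i + m)))" for \<gamma>
    proof -
      have "A (\<Sum>i\<in>{r..n}. smult (\<gamma> i) (gegen m (i + m)))
          = (\<Sum>i\<in>{r..n}. A (smult (\<gamma> i) (gegen m (i + m))))"
        unfolding A_def sum.distrib gegenbauer_op_sum[OF finite_atLeastAtMost]
        by (auto intro!: poly_ext simp: poly_sum sum_distrib_left mult.assoc)
      also have "\<dots> = (\<Sum>i\<in>{r..n}. smult (\<gamma> i * w i) (gegen m (i + m)))"
        unfolding A_def w_def gegenbauer_op_smult gegenbauer_op_pderiv_Tcheb
        by (intro sum.cong refl poly_ext) (simp add: algebra_simps)
      finally show ?thesis .
    qed
    have "polynomial_features TYPE('n) (A (A (\<Sum>i\<in>{r..n}. smult (\<beta> i) (gegen m (i + m)))))"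
      using polynomial_features_gegenbauer[OF card ft] unfolding A_def .
    also have "A (A (\<Sum>i\<in>{r..n}. smult (\<beta> i) (gegen m (i + m))))
        = (\<Sum>i\<in>{r..n}. smult (\<beta> i * w i * w i) (gegen m (i + m)))"
      unfolding A ..
    also have "\<dots> = (\<Sum>i\<in>{Suc r..n}. smult (\<beta> i * w i * w i) (gegen m (i + m)))"
      using Suc.prems by (subst sum.atLeast_Suc_atMost) (auto simp: w_def)
    finally have "polynomial_features TYPE('n) (\<Sum>i\<in>{Suc r..n}. smult (\<beta> i * w i * w i) (gegen m (i + m)))" .
    moreover have "w n \<noteq> 0"
      using Suc.prems power_strict_mono[of "real (r + m)" "real (n + m)" 2] by (simp add: w_def)
    then have "0 < \<beta> n * w n * w n"
      using pos by (auto simp: mult.assoc zero_less_mult_iff linorder_neq_iff)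
    ultimately show ?case
      by (intro exI[of _ "\<lambda>i. \<beta> i * w i * w i"]) auto
  qed
  from this[of n] that show ?thesis by auto
qed

lemma gegen_eq_0: "n < m \<Longrightarrow> gegen m n = 0"
proof -
  assume "n < m"
  then obtain l where l: "m = Suc l + n"
    by (metis add.commute less_iff_Suc_add add_Suc_right add_Suc)
  have "degree (gegen n (0 + n)) \<le> 0"
    using coeff_gegen(1)[of 0 _ n] by (intro degree_le) blast
  then have 0: "pderiv (gegen n n) = 0"
    by (simp add: pderiv_eq_0_iff)
  have "(pderiv ^^ l) 0 = (0 :: real poly)"
    by (induction l) auto
  with 0 show "gegen m n = 0"
    unfolding l funpow_add by (simp add: funpow_swap1)
qed

text \<open>The case \<open>n < m\<close> is included because the smallest frequencies of the series
  may lie below \<open>m\<close>.\<close>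

lemma gegen_positive_definite:
  assumes card: "CARD('n::finite) = 2 * m + 2"
    and x: "\<And>i. i \<in> J \<Longrightarrow> x i \<in> sphere (0 :: real ^ 'n) 1"
  shows "0 \<le> (\<Sum>i\<in>J. \<Sum>j\<in>J. c i * c j * poly (gegen m n) (x i \<bullet> x j))"
proof (cases "m \<le> n")
  case True
  then obtain \<gamma> where \<gamma>: "0 < \<gamma>" "polynomial_features TYPE('n) (smult \<gamma> (gegen m n))"
    using polynomial_features_gegen[OF card, of "n - m"] by auto
  have "0 \<le> (\<Sum>i\<in>J. \<Sum>j\<in>J. c i * c j * poly (smult \<gamma> (gegen m n)) (x i \<bullet> x j))"
    using \<gamma>(2) x by (rule polynomial_features_positive)
  also have "\<dots> = \<gamma> * (\<Sum>i\<in>J. \<Sum>j\<in>J. c i * c j * poly (gegen m n) (x i \<bullet> x j))"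
    by (simp add: sum_distrib_left mult_ac)
  finally show ?thesis
    using \<gamma>(1) by (simp add: zero_le_mult_iff)
next
  case False
  then show ?thesis
    by (simp add: gegen_eq_0)
qed

section \<open>Iterated differentiability\<close>

lemma times_differentiable_at_SucD: "times_differentiable_at (Suc r) f x \<Longrightarrow> times_differentiable_at r f x"
  by (auto dest: eventually_nhds_x_imp_x)

lemma deriv_eventually_eq:
  fixes f g :: "real \<Rightarrow> real"
  assumes "\<forall>\<^sub>F y in nhds x. f y = g y"
  shows "\<forall>\<^sub>F y in nhds x. deriv f y = deriv g y"
proof -
  have "\<forall>\<^sub>F y in nhds x. \<forall>\<^sub>F z in nhds y. f z = g z"
    using assms by (simp add: eventually_eventually)
  then show ?thesis
    by eventually_elim (auto intro: deriv_cong_ev)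
qed

lemma differentiable_cong_ev:
  fixes f g :: "real \<Rightarrow> real"
  assumes "\<forall>\<^sub>F y in nhds x. f y = g y"
  shows "f differentiable at x \<longleftrightarrow> g differentiable at x"
  unfolding real_differentiable_def using DERIV_cong_ev[OF refl assms refl] by auto

lemma times_differentiable_at_cong:
  assumes "\<forall>\<^sub>F y in nhds x. f y = g y"
  shows "times_differentiable_at r f x \<longleftrightarrow> times_differentiable_at r g x"
  using assms
proof (induction r arbitrary: x)
  case (Suc r)
  have "\<forall>\<^sub>F y in nhds x. \<forall>\<^sub>F z in nhds y. f z = g z"
    using Suc.prems by (simp add: eventually_eventually)
  then have "\<forall>\<^sub>F y in nhds x. times_differentiable_at r f y \<longleftrightarrow> times_differentiable_at r g y"
    by eventually_elim (rule Suc.IH)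
  then have "(\<forall>\<^sub>F y in nhds x. times_differentiable_at r f y)
      \<longleftrightarrow> (\<forall>\<^sub>F y in nhds x. times_differentiable_at r g y)"
    by (rule eventually_cong) blast
  moreover have "\<forall>\<^sub>F y in nhds x. (deriv ^^ r) f y = (deriv ^^ r) g y"
    by (induction r) (use Suc.prems deriv_eventually_eq in auto)
  then have "(deriv ^^ r) f differentiable at x \<longleftrightarrow> (deriv ^^ r) g differentiable at x"
    by (rule differentiable_cong_ev)
  ultimately show ?case
    by simp
qed simp

lemma times_differentiable_at_1: "times_differentiable_at (Suc 0) f x \<longleftrightarrow> f differentiable at x"
proof -
  have "\<forall>\<^sub>F y in nhds x. times_differentiable_at 0 f y"
    by (rule always_eventually) simp
  then show ?thesis
    by (simp only: times_differentiable_at.simps(2) funpow_0 simp_thms)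
qed

text \<open>The definition splits off the last derivative, whereas inductions on sums and products
  need the first. Order 1 is excluded, since it asks for differentiability at \<open>x\<close> only
  and not nearby.\<close>

lemma times_differentiable_at_Suc_Suc:
  "times_differentiable_at (Suc (Suc r)) f x \<longleftrightarrow>
     (\<forall>\<^sub>F y in nhds x. f differentiable at y) \<and> times_differentiable_at (Suc r) (deriv f) x"
proof (induction r arbitrary: x)
  case (Suc r)
  have eq: "(deriv ^^ Suc (Suc r)) f = (deriv ^^ Suc r) (deriv f)"
    by (simp add: funpow_swap1)
  have "times_differentiable_at (Suc (Suc (Suc r))) f x \<longleftrightarrow>
      (\<forall>\<^sub>F y in nhds x. times_differentiable_at (Suc (Suc r)) f y) \<and>
      (deriv ^^ Suc r) (deriv f) differentiable at x"
    unfolding times_differentiable_at.simps(2)[of "Suc (Suc r)"] eq ..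
  also have "(\<forall>\<^sub>F y in nhds x. times_differentiable_at (Suc (Suc r)) f y) \<longleftrightarrow>
      (\<forall>\<^sub>F y in nhds x. f differentiable at y) \<and>
      (\<forall>\<^sub>F y in nhds x. times_differentiable_at (Suc r) (deriv f) y)"
    unfolding Suc.IH eventually_conj_iff eventually_eventually ..
  finally show ?case
    unfolding times_differentiable_at.simps(2)[of "Suc r"] by (simp only: conj_assoc)
next
  case 0
  then show ?case
    unfolding times_differentiable_at.simps(2)[of "Suc 0"] times_differentiable_at_1 by simp
qed

lemma times_differentiable_at_add:
  assumes "times_differentiable_at r f x" "times_differentiable_at r g x"
  shows "times_differentiable_at r (\<lambda>y. f y + g y) x"
  using assms
proof (induction r arbitrary: f g)
  case (Suc r)
  show ?case
  proof (cases r)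
    case 0
    with Suc.prems show ?thesis
      by (simp only: times_differentiable_at_1 differentiable_add)
  next
    case r: (Suc m)
    have ev: "\<forall>\<^sub>F y in nhds x. f differentiable at y" "\<forall>\<^sub>F y in nhds x. g differentiable at y"
      and d: "times_differentiable_at r (deriv f) x" "times_differentiable_at r (deriv g) x"
      using Suc.prems unfolding r times_differentiable_at_Suc_Suc by auto
    have "\<forall>\<^sub>F y in nhds x. deriv (\<lambda>y. f y + g y) y = deriv f y + deriv g y"
      using ev by eventually_elim
        (intro DERIV_imp_deriv DERIV_add; simp add: DERIV_deriv_iff_real_differentiable)
    then have "times_differentiable_at r (deriv (\<lambda>y. f y + g y)) x"
      by (rule times_differentiable_at_cong[THEN iffD2]) (rule Suc.IH[OF d])
    moreover have "\<forall>\<^sub>F y in nhds x. (\<lambda>y. f y + g y) differentiable at y"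
      using ev by eventually_elim (rule differentiable_add)
    ultimately show ?thesis
      unfolding r times_differentiable_at_Suc_Suc by blast
  qed
qed simp

lemma times_differentiable_at_mult:
  assumes "times_differentiable_at r f x" "times_differentiable_at r g x"
  shows "times_differentiable_at r (\<lambda>y. f y * g y) x"
  using assms
proof (induction r arbitrary: f g)
  case (Suc r)
  show ?case
  proof (cases r)
    case 0
    with Suc.prems show ?thesis
      by (simp only: times_differentiable_at_1 differentiable_mult)
  next
    case r: (Suc m)
    have ev: "\<forall>\<^sub>F y in nhds x. f differentiable at y" "\<forall>\<^sub>F y in nhds x. g differentiable at y"
      and d: "times_differentiable_at r (deriv f) x" "times_differentiable_at r (deriv g) x"
      using Suc.prems unfolding r times_differentiable_at_Suc_Suc by auto
    \<comment> \<open>The product rule also contains the undifferentiated factors, so these are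
      needed at the lower order.\<close>
    have fg: "times_differentiable_at r f x" "times_differentiable_at r g x"
      using Suc.prems by (auto intro: times_differentiable_at_SucD simp del: times_differentiable_at.simps)
    have "\<forall>\<^sub>F y in nhds x. deriv (\<lambda>y. f y * g y) y = deriv f y * g y + deriv g y * f y"
      using ev by eventually_elim
        (intro DERIV_imp_deriv DERIV_mult; simp add: DERIV_deriv_iff_real_differentiable)
    then have "times_differentiable_at r (deriv (\<lambda>y. f y * g y)) x"
      by (rule times_differentiable_at_cong[THEN iffD2])
        (intro times_differentiable_at_add Suc.IH d fg)
    moreover have "\<forall>\<^sub>F y in nhds x. (\<lambda>y. f y * g y) differentiable at y"
      using ev by eventually_elim (rule differentiable_mult)
    ultimately show ?thesis
      unfolding r times_differentiable_at_Suc_Suc by blast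
  qed
qed simp

lemma times_differentiable_at_antideriv:
  assumes "\<And>y. (f has_real_derivative f' y) (at y)" "times_differentiable_at (Suc r) f' x"
  shows "times_differentiable_at (Suc (Suc r)) f x"
proof -
  have "deriv f = f'"
    using assms(1) by (auto intro: DERIV_imp_deriv)
  with assms show ?thesis
    unfolding times_differentiable_at_Suc_Suc by (auto simp: real_differentiable_def intro!: always_eventually)
qed

lemma funpow_deriv_eq:
  fixes H :: "nat \<Rightarrow> real \<Rightarrow> real"
  assumes "\<And>i x. i < r \<Longrightarrow> (H i has_real_derivative H (Suc i) x) (at x)" and "i \<le> r"
  shows "(deriv ^^ i) (H 0) = H i"
  using assms(2) by (induction i) (auto intro!: DERIV_imp_deriv assms(1))

lemma times_differentiable_atI:
  fixes H :: "nat \<Rightarrow> real \<Rightarrow> real"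
  assumes H: "\<And>i x. i < r \<Longrightarrow> (H i has_real_derivative H (Suc i) x) (at x)"
  shows "times_differentiable_at r (H 0) x"
proof -
  have "times_differentiable_at i (H 0) x" if "i \<le> r" for i
    using that
  proof (induction i arbitrary: x)
    case (Suc i)
    then have "(deriv ^^ i) (H 0) differentiable at x"
      using funpow_deriv_eq[of r H i, OF H] H[of i x] by (auto simp: real_differentiable_def)
    with Suc show ?case
      by (auto intro!: always_eventually)
  qed simp
  then show ?thesis by simp
qed

lemma times_differentiable_at_const: "times_differentiable_at r (\<lambda>_. c) x"
  using times_differentiable_atI[of r "\<lambda>i _. if i = 0 then c else 0" x] by simp

text \<open>Writing a derivative as a phase shift by \<open>pi / 2\<close> gives one formula for all
  orders.\<close>

lemma has_derivative_cos_shifted: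
  "((\<lambda>t. a ^ i * cos (a * t + real i * (pi / 2))) has_real_derivative
      a ^ Suc i * cos (a * t + real (Suc i) * (pi / 2))) (at t)"
proof -
  have "cos (a * t + real (Suc i) * (pi / 2)) = - sin (a * t + real i * (pi / 2))"
    using minus_sin_cos_eq[of "a * t + real i * (pi / 2)"] by (simp add: algebra_simps add_divide_distrib)
  then show ?thesis
    by (auto intro!: derivative_eq_intros simp: algebra_simps)
qed

lemma times_differentiable_at_sin: "times_differentiable_at r sin x"
proof -
  let ?H = "\<lambda>i t. sin (t + real i * (pi / 2))"
  have "(?H i has_real_derivative ?H (Suc i) t) (at t)" for i t
  proof -
    have "sin (t + real (Suc i) * (pi / 2)) = cos (t + real i * (pi / 2))"
      using sin_add[of "t + real i * (pi / 2)" "pi / 2"] by (simp add: algebra_simps add_divide_distrib)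
    then show ?thesis
      by (auto intro!: derivative_eq_intros)
  qed
  then have "times_differentiable_at r (?H 0) x"
    by (rule times_differentiable_atI)
  then show ?thesis by simp
qed

section \<open>Function series and the cusp of a lacunary cosine sum\<close>

lemma has_derivative_suminf:
  fixes f f' :: "nat \<Rightarrow> real \<Rightarrow> real"
  assumes d: "\<And>j x. (f j has_real_derivative f' j x) (at x)"
    and b: "\<And>j x. \<bar>f j x\<bar> \<le> B j" "\<And>j x. \<bar>f' j x\<bar> \<le> B j" and B: "summable B"
  shows "((\<lambda>x. \<Sum>j. f j x) has_real_derivative (\<Sum>j. f' j x)) (at x)"
proof (rule has_field_derivative_series'(2)[where S = UNIV])
  show "uniformly_convergent_on UNIV (\<lambda>n x. \<Sum>i<n. f' i x)"
    using b(2) B by (intro Weierstrass_m_test'[where M = B]) auto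
  show "summable (\<lambda>j. f j 0)"
    using b(1) by (intro summable_comparison_test[OF _ B]) auto
qed (use d in auto)

lemma continuous_on_suminf:
  fixes f :: "nat \<Rightarrow> real \<Rightarrow> real"
  assumes "\<And>j. continuous_on A (f j)" "\<And>j x. x \<in> A \<Longrightarrow> \<bar>f j x\<bar> \<le> B j" "summable B"
  shows "continuous_on A (\<lambda>x. \<Sum>j. f j x)"
proof (rule uniform_limit_theorem)
  show "uniform_limit A (\<lambda>n x. \<Sum>j<n. f j x) (\<lambda>x. \<Sum>j. f j x) sequentially"
    using assms by (intro Weierstrass_m_test[where M = B]) auto
  show "\<forall>\<^sub>F n in sequentially. continuous_on A (\<lambda>x. \<Sum>j<n. f j x)"
    using assms(1) by (intro always_eventually allI continuous_on_sum)
qed simp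

text \<open>The sum is even, so its derivative at 0 could only be 0; but along a sequence tending to
  0 the difference quotients stay at or below \<open>- 2 / pi\<close>.\<close>

lemma lacunary_cusp:
  "\<not> (\<lambda>t :: real. \<Sum>j. (1 / 4) ^ Suc j * cos (4 ^ Suc j * t)) differentiable at 0"
proof
  let ?f = "\<lambda>j (t :: real). (1 / 4) ^ Suc j * cos (4 ^ Suc j * t)"
  define g where "g t = (\<Sum>j. ?f j t)" for t
  assume "(\<lambda>t. \<Sum>j. ?f j t) differentiable at 0"
  then have "g differentiable at 0"
    by (simp only: g_def[abs_def])
  then obtain D where D: "(g has_real_derivative D) (at 0)"
    by (auto simp: real_differentiable_def)
  have geo: "summable (\<lambda>j. (1 / 4 :: real) ^ Suc j)"
    by (simp add: summable_geometric)
  have sum: "summable (\<lambda>j. ?f j t)" for t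
    using geo by (rule summable_comparison_test[rotated])
      (auto simp: abs_mult intro!: mult_left_le)
  have "g (- t) = g t" for t
    by (simp add: g_def)
  moreover have "((\<lambda>t. g (- t)) has_real_derivative D * - 1) (at 0)"
    by (rule DERIV_chain2[where g = uminus]) (use D in \<open>auto intro!: derivative_eq_intros\<close>)
  ultimately have "(g has_real_derivative - D) (at 0)"
    by simp
  with D have "D = - D"
    by (rule DERIV_unique)
  then have "D = 0" by simp
  with D have lim: "(\<lambda>t. (g t - g 0) / t) \<midarrow>0\<rightarrow> 0"
    by (simp add: DERIV_def)
  \<comment> \<open>At \<open>h J\<close> the cosine of index \<open>J\<close> has argument
    \<open>pi\<close> and has dropped from 1 to -1, while no other term exceeds its value at
    0.\<close>
  define h where "h J = pi * (1 / 4 :: real) ^ Suc J" for J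
  have h: "h J > 0" for J
    by (simp add: h_def)
  have "h \<longlonglongrightarrow> pi * 0"
    unfolding h_def by (intro tendsto_intros LIMSEQ_Suc LIMSEQ_power_zero) auto
  then have "filterlim h (at 0) sequentially"
    using h by (intro filterlim_atI) (auto intro!: always_eventually less_imp_neq[THEN not_sym])
  with lim have "(\<lambda>J. (g (h J) - g 0) / h J) \<longlonglongrightarrow> 0"
    by (rule filterlim_compose)
  moreover have "(g (h J) - g 0) / h J \<le> - 2 / pi" for J
  proof -
    have "2 * (1 / 4) ^ Suc J = ?f J 0 - ?f J (h J)"
      by (simp add: h_def power_one_over)
    also have "\<dots> \<le> (\<Sum>j. ?f j 0 - ?f j (h J))"
      using sum_le_suminf[OF summable_diff[OF sum[of 0] sum[of "h J"]], of "{J}"]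
      by (simp add: algebra_simps mult_left_le)
    also have "\<dots> = g 0 - g (h J)"
      unfolding g_def by (rule suminf_diff[symmetric]) (rule sum)+
    finally have "g (h J) - g 0 \<le> - 2 / pi * h J"
      by (simp add: h_def)
    then show ?thesis
      using h[of J] by (simp only: pos_divide_le_eq)
  qed
  ultimately have "0 \<le> - 2 / pi"
    by (intro LIMSEQ_le_const2) auto
  then show False
    using pi_gt_zero by (simp add: field_simps)
qed

section \<open>The lacunary series\<close>

text \<open>Termwise differentiation of a cosine sum of degree at most \<open>n\<close> costs at
  most a factor \<open>n\<close> per order.\<close>

lemma Tcone_derivatives:
  assumes "p \<in> Tcone n"
  shows "\<exists>H. H 0 = (\<lambda>t. poly p (cos t)) \<and>
    (\<forall>i t. (H i has_real_derivative H (Suc i) t) (at t)) \<and>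
    (\<forall>i t. \<bar>H i t\<bar> \<le> real n ^ i * poly p 1)"
proof -
  obtain c where c: "\<forall>l. 0 \<le> c l" and p: "p = (\<Sum>l\<le>n. smult (c l) (Tcheb l))"
    using assms unfolding Tcone_def by blast
  let ?H = "\<lambda>i t. \<Sum>l\<le>n. c l * (real l ^ i * cos (real l * t + real i * (pi / 2)))"
  have "?H 0 = (\<lambda>t. poly p (cos t))"
    unfolding p by (simp add: poly_sum poly_Tcheb_cos)
  moreover have "(?H i has_real_derivative ?H (Suc i) t) (at t)" for i t
    by (intro DERIV_sum DERIV_cmult has_derivative_cos_shifted)
  moreover have "\<bar>?H i t\<bar> \<le> real n ^ i * poly p 1" for i t
  proof -
    have "\<bar>?H i t\<bar> \<le> (\<Sum>l\<le>n. c l * real n ^ i)"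
    proof (rule order.trans[OF sum_abs], rule sum_mono)
      fix l assume "l \<in> {..n}"
      then have "real l ^ i * \<bar>cos (real l * t + real i * (pi / 2))\<bar> \<le> real n ^ i * 1"
        by (intro mult_mono power_mono abs_cos_le_one) auto
      then show "\<bar>c l * (real l ^ i * cos (real l * t + real i * (pi / 2)))\<bar> \<le> c l * real n ^ i"
        using c by (simp add: abs_mult mult_left_mono)
    qed
    also have "\<dots> = real n ^ i * poly p 1"
      unfolding p by (simp add: poly_sum sum_distrib_right mult.commute)
    finally show ?thesis .
  qed
  ultimately show ?thesis
    by (intro exI[of _ ?H]) blast
qed

lemma abs_poly_Tcone_le: "p \<in> Tcone n \<Longrightarrow> \<bar>poly p (cos t)\<bar> \<le> poly p 1"
  by (metis Tcone_derivatives mult_1 power_0)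

text \<open>The weights do not depend on \<open>i\<close>, so that differentiation links
  \<open>i\<close> to \<open>Suc i\<close>. Frequencies start at 4, which makes all of them
  multiples of 4.\<close>

definition lacunary :: "nat \<Rightarrow> nat \<Rightarrow> real \<Rightarrow> real" where
  "lacunary M i t = (\<Sum>j. (1 / 4 ^ Suc j) ^ (2 * M + 1) * poly (gegen i (4 ^ Suc j)) (cos t))"

text \<open>Growth of order at most \<open>2 * M\<close> in the frequency leaves one inverse
  frequency of the weight, a geometric majorant.\<close>

lemma lacunary_bound:
  fixes v :: real
  assumes "\<bar>v\<bar> \<le> real (4 ^ Suc j) ^ e" "e \<le> 2 * M"
  shows "\<bar>(1 / 4 ^ Suc j) ^ (2 * M + 1) * v\<bar> \<le> (1 / 4) ^ Suc j"
proof -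
  define a :: real where "a = 4 ^ Suc j"
  have a: "1 \<le> a"
    unfolding a_def by (rule one_le_power) simp
  have "\<bar>v\<bar> \<le> a ^ (2 * M)"
    using assms(1) power_increasing[OF assms(2) a] by (simp add: a_def)
  then have "(1 / a) ^ (2 * M + 1) * \<bar>v\<bar> \<le> (1 / a) ^ (2 * M + 1) * a ^ (2 * M)"
    using a by (intro mult_left_mono) auto
  also have "\<dots> = 1 / a"
    using a by (simp add: field_simps)
  finally have "(1 / a) ^ (2 * M + 1) * \<bar>v\<bar> \<le> 1 / a" .
  moreover have "\<bar>(1 / a) ^ (2 * M + 1)\<bar> = (1 / a) ^ (2 * M + 1)"
    using a by (intro abs_of_nonneg) auto
  ultimately show ?thesis
    unfolding abs_mult power_one_over[of 4 "Suc j"] a_def[symmetric] by (simp only:)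
qed

lemma summable_quarter: "summable (\<lambda>j. (1 / 4 :: real) ^ Suc j)"
  by (simp add: summable_geometric)

lemma lacunary_term_bound:
  assumes "i \<le> M"
  shows "\<bar>(1 / 4 ^ Suc j) ^ (2 * M + 1) * poly (gegen i (4 ^ Suc j)) (cos t)\<bar> \<le> (1 / 4) ^ Suc j"
proof (rule lacunary_bound)
  show "\<bar>poly (gegen i (4 ^ Suc j)) (cos t)\<bar> \<le> real (4 ^ Suc j) ^ (2 * i)"
    by (rule order.trans[OF abs_poly_Tcone_le[OF gegen_in_Tcone] poly_gegen_1_le])
qed (use assms in simp)

lemma lacunary_summable:
  assumes "i \<le> M"
  shows "summable (\<lambda>j. (1 / 4 ^ Suc j) ^ (2 * M + 1) * poly (gegen i (4 ^ Suc j)) (cos t))"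
  by (rule summable_comparison_test[OF _ summable_quarter])
    (use lacunary_term_bound[OF assms] in auto)

lemma continuous_on_lacunary: "i \<le> M \<Longrightarrow> continuous_on A (lacunary M i)"
  unfolding lacunary_def
  by (rule continuous_on_suminf[OF _ lacunary_term_bound summable_quarter])
    (auto intro!: continuous_intros)

lemma lacunary_deriv:
  assumes "Suc i \<le> M"
  shows "(lacunary M i has_real_derivative - sin t * lacunary M (Suc i) t) (at t)"
proof -
  let ?b = "\<lambda>j. (1 / 4 ^ Suc j :: real) ^ (2 * M + 1)"
  have "((\<lambda>t. \<Sum>j. ?b j * poly (gegen i (4 ^ Suc j)) (cos t)) has_real_derivative
      (\<Sum>j. - sin t * (?b j * poly (gegen (Suc i) (4 ^ Suc j)) (cos t)))) (at t)"
  proof (rule has_derivative_suminf[OF _ _ _ summable_quarter])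
    show "((\<lambda>t. ?b j * poly (gegen i (4 ^ Suc j)) (cos t)) has_real_derivative
        - sin t * (?b j * poly (gegen (Suc i) (4 ^ Suc j)) (cos t))) (at t)" for j t
      using DERIV_cmult[OF DERIV_chain2[OF poly_DERIV DERIV_cos], of "?b j" "gegen i (4 ^ Suc j)" t]
      by (simp add: mult_ac)
    show "\<bar>?b j * poly (gegen i (4 ^ Suc j)) (cos t)\<bar> \<le> (1 / 4) ^ Suc j" for j t
      using assms by (intro lacunary_term_bound) simp
    show "\<bar>- sin t * (?b j * poly (gegen (Suc i) (4 ^ Suc j)) (cos t))\<bar> \<le> (1 / 4) ^ Suc j" for j t
    proof -
      have "\<bar>sin t\<bar> * \<bar>?b j * poly (gegen (Suc i) (4 ^ Suc j)) (cos t)\<bar> \<le> 1 * (1 / 4) ^ Suc j"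
        by (intro mult_mono lacunary_term_bound assms) auto
      then show ?thesis
        by (simp only: abs_mult abs_minus_cancel mult_1)
    qed
  qed
  then show ?thesis
    unfolding lacunary_def suminf_mult[OF lacunary_summable[OF assms]] .
qed

lemma lacunary_positive:
  assumes "i \<le> M"
  shows "0 < lacunary M i 0"
proof -
  have nonneg: "0 \<le> poly (gegen i n) 1" for n
    using abs_poly_Tcone_le[OF gegen_in_Tcone, of i n 0] by simp
  \<comment> \<open>All terms at 0 are nonnegative; the one of index \<open>i\<close> is strictly
    positive because its frequency is at least \<open>i\<close>.\<close>
  have "i < 4 ^ i"
    by (induction i) auto
  then have "i \<le> 4 ^ Suc i"
    by simp
  then have "0 < poly (gegen i (4 ^ Suc i)) 1"
    by (rule poly_gegen_1_pos)
  then show ?thesis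
    unfolding lacunary_def using nonneg
    by (intro suminf_pos2[OF lacunary_summable[OF assms], of _ i]) auto
qed

text \<open>A term has size at most \<open>n^(2 m)\<close> before the weight, and each of the
  \<open>2 * k\<close> derivatives costs a factor \<open>n\<close>; this exhausts the exponent
  \<open>2 * M\<close> for \<open>M = m + k\<close>.\<close>

lemma lacunary_times_differentiable_at:
  "times_differentiable_at (2 * k) (lacunary (m + k) m) t"
proof -
  let ?b = "\<lambda>j. (1 / 4 ^ Suc j :: real) ^ (2 * (m + k) + 1)"
  obtain H where H0: "\<And>n. H n 0 = (\<lambda>t. poly (gegen m n) (cos t))"
    and H: "\<And>n i t. (H n i has_real_derivative H n (Suc i) t) (at t)"
    and bound: "\<And>n i t. \<bar>H n i t\<bar> \<le> real n ^ i * poly (gegen m n) 1"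
    using Tcone_derivatives[OF gegen_in_Tcone[of m]] by metis
  have b: "\<bar>?b j * H (4 ^ Suc j) i t\<bar> \<le> (1 / 4) ^ Suc j" if "i \<le> 2 * k" for i j t
  proof (rule lacunary_bound)
    have "\<bar>H (4 ^ Suc j) i t\<bar> \<le> real (4 ^ Suc j) ^ i * real (4 ^ Suc j) ^ (2 * m)"
      using bound by (rule order.trans) (intro mult_left_mono poly_gegen_1_le, simp)
    then show "\<bar>H (4 ^ Suc j) i t\<bar> \<le> real (4 ^ Suc j) ^ (i + 2 * m)"
      unfolding power_add .
  qed (use that in simp)
  have "times_differentiable_at (2 * k) ((\<lambda>i t. \<Sum>j. ?b j * H (4 ^ Suc j) i t) 0) t"
    by (intro times_differentiable_atI[where H = "\<lambda>i t. \<Sum>j. ?b j * H (4 ^ Suc j) i t"]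
        has_derivative_suminf[OF _ b b summable_quarter] DERIV_cmult H) auto
  then show ?thesis
    by (simp add: H0 lacunary_def[abs_def])
qed

text \<open>All frequencies are multiples of 4, so the derivative of order \<open>2 * M\<close> looks
  at \<open>pi / 2\<close> as it does at the origin, where it has a symmetric cusp.\<close>

lemma lacunary_not_differentiable:
  "\<not> times_differentiable_at (2 * M + 1) (lacunary M 0) (pi / 2)"
proof
  let ?b = "\<lambda>j. (1 / 4 ^ Suc j :: real) ^ (2 * M + 1)"
  define H where "H i t = (\<Sum>j. ?b j * ((4 ^ Suc j) ^ i * cos (4 ^ Suc j * t + real i * (pi / 2))))" for i t
  have b: "\<bar>?b j * ((4 ^ Suc j) ^ i * cos (4 ^ Suc j * t + real i * (pi / 2)))\<bar> \<le> (1 / 4) ^ Suc j"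
    if "i \<le> 2 * M" for i j t
    using that by (intro lacunary_bound[where e = i]) (auto simp: abs_mult intro!: mult_left_le)
  have H: "(H i has_real_derivative H (Suc i) t) (at t)" if "i < 2 * M" for i t
    unfolding H_def
    by (intro has_derivative_suminf[OF _ b b summable_quarter] DERIV_cmult has_derivative_cos_shifted)
      (use that in simp_all)
  have H0: "H 0 = lacunary M 0"
    by (intro ext) (simp add: H_def lacunary_def poly_Tcheb_cos del: power_Suc)
  assume "times_differentiable_at (2 * M + 1) (lacunary M 0) (pi / 2)"
  then have "(deriv ^^ (2 * M)) (H 0) differentiable at (pi / 2)"
    by (simp add: H0)
  then have "H (2 * M) differentiable at (pi / 2)"
    using funpow_deriv_eq[of "2 * M" H "2 * M"] H by simp
  then obtain D where "(H (2 * M) has_real_derivative D) (at (pi / 2 + 0))"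
    by (auto simp: real_differentiable_def)
  then have "((\<lambda>t. H (2 * M) (pi / 2 + t)) has_real_derivative D) (at 0)"
    using DERIV_shift[of "H (2 * M)" D 0 "pi / 2"] by (simp add: add.commute)
  \<comment> \<open>\<open>cos (real M * pi)\<close> is 1 or -1; multiplying by it cancels the sign
    caused by the phase \<open>real (2 * M) * (pi / 2)\<close>.\<close>
  then have D: "((\<lambda>t. cos (real M * pi) * H (2 * M) (pi / 2 + t)) has_real_derivative cos (real M * pi) * D) (at 0)"
    by (rule DERIV_cmult)
  have "?b j * ((4 ^ Suc j) ^ (2 * M) * cos (4 ^ Suc j * (pi / 2 + t) + real (2 * M) * (pi / 2)))
      = cos (real M * pi) * ((1 / 4) ^ Suc j * cos (4 ^ Suc j * t))" for j t
  proof -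
    \<comment> \<open>Moving the origin to \<open>pi / 2\<close> shifts the phase by
      \<open>4 ^ j\<close> full periods.\<close>
    have "4 ^ Suc j * (pi / 2 + t) + real (2 * M) * (pi / 2)
        = (4 ^ Suc j * t + real M * pi) + 2 * pi * of_int (4 ^ j)"
      by (simp add: algebra_simps)
    then have "cos (4 ^ Suc j * (pi / 2 + t) + real (2 * M) * (pi / 2)) = cos (4 ^ Suc j * t + real M * pi)"
      by (simp only: cos_int_2pin sin_int_2pin cos_add[of _ "2 * pi * _"] mult_1_right mult_zero_right diff_zero)
    also have "\<dots> = cos (real M * pi) * cos (4 ^ Suc j * t)"
      by (simp add: cos_add)
    finally have c: "cos (4 ^ Suc j * (pi / 2 + t) + real (2 * M) * (pi / 2))
      = cos (real M * pi) * cos (4 ^ Suc j * t)" .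
    have "?b j * (4 ^ Suc j) ^ (2 * M) = (1 / 4) ^ Suc j"
      by (simp add: power_one_over field_simps)
    then show ?thesis
      unfolding c by (simp only: mult.assoc[symmetric]) (simp only: mult_ac)
  qed
  moreover have "summable (\<lambda>j. (1 / 4) ^ Suc j * cos (4 ^ Suc j * t :: real))" for t
    using summable_quarter by (rule summable_comparison_test[rotated])
      (auto simp: abs_mult intro!: mult_left_le)
  ultimately have "H (2 * M) (pi / 2 + t) = cos (real M * pi) * (\<Sum>j. (1 / 4) ^ Suc j * cos (4 ^ Suc j * t))" for t
    unfolding H_def by (simp only: suminf_mult)
  moreover have "cos (real M * pi) * cos (real M * pi) = 1"
    by (simp add: cos_npi flip: power_mult_distrib)
  ultimately have "(\<lambda>t. cos (real M * pi) * H (2 * M) (pi / 2 + t))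
      = (\<lambda>t. \<Sum>j. (1 / 4) ^ Suc j * cos (4 ^ Suc j * t))"
    by (simp only: mult.assoc[symmetric] mult_1)
  with D lacunary_cusp show False
    by (metis real_differentiable_def)
qed

section \<open>Membership in \<open>Psi_class\<close> and loss of smoothness at
  \<open>pi / 2\<close>\<close>

theorem mainTheorem2:
  fixes d k :: nat
  assumes "d \<ge> 1" and "odd d" and "CARD('n::finite) = d + 1"
  shows "\<exists>\<psi> \<in> Psi_class TYPE('n).
           times_differentiable_at_zero (2 * k) \<psi> \<and>
           (\<exists>x\<in>{0<..<pi}. \<not> times_differentiable_at (2 * k + (d - 1) div 2 + 1) \<psi> x)"
proof -
  obtain m where d: "d = 2 * m + 1"
    using \<open>odd d\<close> by (rule oddE)
  then have card: "CARD('n) = 2 * m + 2"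
    using assms(3) by simp
  define M where "M = m + k"
  have mM: "m \<le> M"
    by (simp add: M_def)
  define \<psi> where "\<psi> t = 1 / lacunary M m 0 * lacunary M m t" for t
  have pos: "0 < lacunary M m 0"
    using mM by (rule lacunary_positive)
  have "positive_definite_on (sphere (0 :: real ^ 'n) 1) (\<lambda>x y. \<psi> (sphere_angle x y))"
    unfolding positive_definite_on_def
  proof (intro allI impI)
    fix n :: nat and x :: "nat \<Rightarrow> real ^ 'n" and c :: "nat \<Rightarrow> real"
    assume x: "\<forall>i\<in>{1..n}. x i \<in> sphere 0 1"
    let ?b = "\<lambda>j. (1 / 4 ^ Suc j :: real) ^ (2 * M + 1)"
    let ?p = "\<lambda>j. gegen m (4 ^ Suc j)"
    let ?t = "\<lambda>i l. sphere_angle (x i) (x l)"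
    have cos: "cos (?t i l) = x i \<bullet> x l" if "i \<in> {1..n}" "l \<in> {1..n}" for i l
    proof -
      have "\<bar>x i \<bullet> x l\<bar> \<le> 1"
        using Cauchy_Schwarz_ineq2[of "x i" "x l"] x that by simp
      then show ?thesis
        by (simp add: sphere_angle_def cos_arccos_abs)
    qed
    have sums: "(\<lambda>j. c i * c l * (?b j * poly (?p j) (cos (?t i l)))) sums
        (c i * c l * lacunary M m (?t i l))" for i l
      unfolding lacunary_def by (intro sums_mult summable_sums lacunary_summable mM)
    \<comment> \<open>Only finitely many points are involved, so the quadratic form is itself a
      convergent series of nonnegative forms.\<close>
    have total: "(\<lambda>j. \<Sum>i=1..n. \<Sum>l=1..n. c i * c l * (?b j * poly (?p j) (cos (?t i l)))) sums
        (\<Sum>i=1..n. \<Sum>l=1..n. c i * c l * lacunary M m (?t i l))"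
      by (intro sums_sum sums)
    have "0 \<le> (\<Sum>i=1..n. \<Sum>l=1..n. c i * c l * (?b j * poly (?p j) (cos (?t i l))))" for j
    proof -
      have "0 \<le> ?b j * (\<Sum>i=1..n. \<Sum>l=1..n. c i * c l * poly (?p j) (x i \<bullet> x l))"
        using x by (intro mult_nonneg_nonneg gegen_positive_definite[OF card]) auto
      also have "\<dots> = (\<Sum>i=1..n. \<Sum>l=1..n. c i * c l * (?b j * poly (?p j) (cos (?t i l))))"
        unfolding sum_distrib_left by (intro sum.cong refl) (simp add: cos mult_ac)
      finally show ?thesis .
    qed
    then have "0 \<le> (\<Sum>i=1..n. \<Sum>l=1..n. c i * c l * lacunary M m (?t i l))"
      by (rule sums_le[OF _ sums_zero total])
    then have "0 \<le> 1 / lacunary M m 0 * (\<Sum>i=1..n. \<Sum>l=1..n. c i * c l * lacunary M m (?t i l))"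
      using pos by simp
    also have "\<dots> = (\<Sum>i=1..n. \<Sum>l=1..n. c i * c l * \<psi> (?t i l))"
      unfolding sum_distrib_left \<psi>_def by (intro sum.cong refl) (simp only: mult_ac)
    finally show "0 \<le> (\<Sum>i=1..n. \<Sum>l=1..n. c i * c l * \<psi> (?t i l))" .
  qed
  moreover have "continuous_on {0..pi} \<psi>"
    unfolding \<psi>_def by (intro continuous_intros continuous_on_lacunary mM)
  moreover have "\<psi> 0 = 1"
    using pos by (simp add: \<psi>_def)
  ultimately have "\<psi> \<in> Psi_class TYPE('n)"
    by (simp add: Psi_class_def)
  moreover have "times_differentiable_at_zero (2 * k) \<psi>"
  proof -
    \<comment> \<open>The series is already even, so the even continuation is \<open>\<psi>\<close>
      itself.\<close>
    have "cos \<bar>t\<bar> = cos t" for t :: real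
      by (simp add: abs_if)
    then have "(\<lambda>t. \<psi> \<bar>t\<bar>) = \<psi>"
      by (simp add: \<psi>_def lacunary_def fun_eq_iff)
    then show ?thesis
      unfolding times_differentiable_at_zero_def \<psi>_def M_def
      by (simp only: times_differentiable_at_mult times_differentiable_at_const
          lacunary_times_differentiable_at)
  qed
  moreover have "\<not> times_differentiable_at (2 * k + m + 1) \<psi> (pi / 2)"
  proof
    assume "times_differentiable_at (2 * k + m + 1) \<psi> (pi / 2)"
    then have "times_differentiable_at (2 * k + m + 1) (\<lambda>t. lacunary M m 0 * \<psi> t) (pi / 2)"
      by (intro times_differentiable_at_mult times_differentiable_at_const)
    then have start: "times_differentiable_at (2 * k + m + 1) (lacunary M m) (pi / 2)"
      using pos by (simp add: \<psi>_def)
    have "times_differentiable_at (2 * k + m + 1 + i) (lacunary M (m - i)) (pi / 2)" if "i \<le> m" for i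
      using that
    proof (induction i)
      case 0
      then show ?case using start by simp
    next
      case (Suc i)
      have eq: "Suc (m - Suc i) = m - i"
        using Suc.prems by simp
      \<comment> \<open>This product is the derivative of \<open>lacunary M (m - Suc i)\<close>, so
        each step gains one order; \<open>m\<close> steps lead to
        \<open>2 * k + 2 * m + 1 = 2 * M + 1\<close>.\<close>
      have "times_differentiable_at (Suc (2 * k + m + i)) (\<lambda>t. (-1 * sin t) * lacunary M (m - i) t) (pi / 2)"
        using Suc by (intro times_differentiable_at_mult times_differentiable_at_const times_differentiable_at_sin)
          simp
      then have "times_differentiable_at (Suc (Suc (2 * k + m + i))) (lacunary M (m - Suc i)) (pi / 2)"
        by (rule times_differentiable_at_antideriv[rotated])
          (use lacunary_deriv[of "m - Suc i" M] mM eq in simp)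
      then show ?case
        by (simp only: add_Suc_right add_Suc Suc_eq_plus1[symmetric])
    qed
    from this[of m] have "times_differentiable_at (2 * M + 1) (lacunary M 0) (pi / 2)"
      by (simp add: M_def algebra_simps del: times_differentiable_at.simps)
    then show False
      using lacunary_not_differentiable by blast
  qed
  moreover have "(d - 1) div 2 = m" and "pi / 2 \<in> {0<..<pi}"
    by (simp_all add: d)
  ultimately show ?thesis
    by (intro bexI[of _ \<psi>] conjI bexI[of _ "pi / 2"]) (simp_all only: not_False_eq_True)
qed

end
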